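(* Let $D$ be the derivation on Laurent polynomials in the commuting variables $a,x,z,v,u$ determined by the grammar $$a\to axv,\quad x\to xvz,\quad z\to vz^2,\quad v\to uv^2z,\quad u\to u^2vz$$ (i.e. $D(a)=axv$, $D(x)=xvz$, etc., extended by linearity and the Leibniz rule). Then for $n\ge1$, $$D^n(a)=av^n\sum_{k=0}^{n-1}\ \sum_{T\in\mathcal{T}_{n+1,k}}x^{\deg_T(1)}z^{n-\deg_T(1)}u^k,$$ or equivalently $$D^n(a)=axv^nz^{n-1}\sum_{k=0}^{n-1}Q_{n,k}(xz^{-1})\,u^k.$$
   Context: For a rooted tree, an edge is written $(i,j)$ where $j$ is a child of $i$; every vertex is a descendant of itself; the edge $(i,j)$ is improper if some descendant of $j$ is smaller than $i$. $\mathcal{T}_{n+1,k}$ denotes the set of rooted trees on $\{1,\dots,n+1\}$ with root $1$ and exactly $k$ improper edges. $\deg_T(i)$ is the number of children of $i$ in $T$. The Ramanujan polynomials are $Q_{n,k}(x)=\sum_{T\in\mathcal{T}_{n+1,k}}x^{\deg_T(1)-1}$. *)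

theory Defs
  imports "HOL-Library.Poly_Mapping" "HOL-Computational_Algebra.Polynomial"
begin

section \<open>Laurent polynomials and derivations\<close>

datatype gvar = A | X | Z | V | U

text \<open>
  A monomial is its vector of integer exponents. Multiplication of polynomial mappings is
  convolution, so this is the ring of Laurent polynomials in the five variables over \<open>'c\<close>.
\<close>

type_synonym 'c laurent = "(gvar \<Rightarrow>\<^sub>0 int) \<Rightarrow>\<^sub>0 'c"

definition lpow :: "gvar \<Rightarrow> int \<Rightarrow> 'c::comm_ring_1 laurent" where
  "lpow g e = Poly_Mapping.single (Poly_Mapping.single g e) 1"

definition lvar :: "gvar \<Rightarrow> 'c::comm_ring_1 laurent" where
  "lvar g = lpow g 1"

definition lconst :: "'c \<Rightarrow> 'c::comm_ring_1 laurent" where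
  "lconst c = Poly_Mapping.single 0 c"

definition is_derivation :: "('c::comm_ring_1 laurent \<Rightarrow> 'c laurent) \<Rightarrow> bool" where
  "is_derivation D \<longleftrightarrow>
     (\<forall>p q. D (p + q) = D p + D q) \<and>
     (\<forall>c p. D (lconst c * p) = lconst c * D p) \<and>
     (\<forall>p q. D (p * q) = D p * q + p * D q)"

definition obeys_grammar :: "('c::comm_ring_1 laurent \<Rightarrow> 'c laurent) \<Rightarrow> bool" where
  "obeys_grammar D \<longleftrightarrow>
     D (lvar A) = lvar A * lvar X * lvar V \<and>
     D (lvar X) = lvar X * lvar V * lvar Z \<and>
     D (lvar Z) = lvar V * lvar Z ^ 2 \<and>
     D (lvar V) = lvar U * lvar V ^ 2 * lvar Z \<and>
     D (lvar U) = lvar U ^ 2 * lvar V * lvar Z"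

section \<open>Rooted labelled trees\<close>

text \<open>A rooted tree is given by its set of edges, written \<open>(parent, child)\<close>.\<close>

definition is_rooted_tree :: "'a set \<Rightarrow> 'a \<Rightarrow> ('a \<times> 'a) set \<Rightarrow> bool" where
  "is_rooted_tree W r T \<longleftrightarrow>
     T \<subseteq> W \<times> W \<and> r \<in> W \<and>
     (\<forall>i. (i, r) \<notin> T) \<and>
     (\<forall>j \<in> W - {r}. \<exists>!i. (i, j) \<in> T) \<and>
     (\<forall>j \<in> W. (r, j) \<in> T\<^sup>*)"

definition descendants :: "('a \<times> 'a) set \<Rightarrow> 'a \<Rightarrow> 'a set" where
  "descendants T j = {d. (j, d) \<in> T\<^sup>*}"

definition improper_edges :: "(nat \<times> nat) set \<Rightarrow> (nat \<times> nat) set" where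
  "improper_edges T = {(i, j) \<in> T. \<exists>d \<in> descendants T j. d < i}"

definition num_children :: "('a \<times> 'a) set \<Rightarrow> 'a \<Rightarrow> nat" where
  "num_children T i = card {j. (i, j) \<in> T}"

definition trees :: "nat \<Rightarrow> nat \<Rightarrow> (nat \<times> nat) set set" where
  "trees m k = {T. is_rooted_tree {1..m} 1 T \<and> card (improper_edges T) = k}"

text \<open>
  The natural-number subtraction in the exponent is exact for \<open>n \<ge> 1\<close>, where the root
  has at least one child.
\<close>

definition ramanujan_poly :: "nat \<Rightarrow> nat \<Rightarrow> int poly" where
  "ramanujan_poly n k = (\<Sum>T \<in> trees (n + 1) k. monom 1 (num_children T 1 - 1))"

section \<open>The grammar determines a derivation\<close>

lemma poly_mapping_single_induct [case_names single add]:
  assumes "\<And>m c. P (Poly_Mapping.single m c)" "\<And>p q. P p \<Longrightarrow> P q \<Longrightarrow> P (p + q)"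
  shows "P (p :: 'a \<Rightarrow>\<^sub>0 'b::comm_monoid_add)"
proof (induction p rule: update_induct)
  case const
  show ?case using assms(1)[of undefined 0] by simp
next
  case (update f a b)
  have "Poly_Mapping.update a b f = f + Poly_Mapping.single a b"
    using update(1) by (intro poly_mapping_eqI)
      (auto simp: lookup_update lookup_add lookup_single when_def in_keys_iff)
  then show ?case using assms update(3) by simp
qed

lemma lpow_add: "lpow g (e + f) = lpow g e * lpow g f"
  by (simp add: lpow_def mult_single single_add)

lemma lpow_0: "lpow g 0 = 1"
  by (simp add: lpow_def)

lift_definition euler :: "gvar \<Rightarrow> 'c::comm_ring_1 laurent \<Rightarrow> 'c laurent"
  is "\<lambda>g p m. of_int (Poly_Mapping.lookup m g) * p m"
  by (rule finite_subset) auto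

lemma euler_add: "euler g (p + q) = euler g p + euler g q"
  by transfer (simp add: fun_eq_iff algebra_simps)

lemma euler_single:
  "euler g (Poly_Mapping.single m c) = Poly_Mapping.single m (of_int (Poly_Mapping.lookup m g) * c)"
  by transfer (auto simp: fun_eq_iff when_def)

lemma euler_mult: "euler g (p * q) = euler g p * q + p * euler g q"
proof (induction p rule: poly_mapping_single_induct)
  case (single m c)
  show ?case
  proof (induction q rule: poly_mapping_single_induct)
    case (single m' c')
    show ?case
      by (simp add: euler_single mult_single lookup_add single_add[symmetric] algebra_simps)
  next
    case (add p q)
    then show ?case by (simp add: euler_add algebra_simps)
  qed
next
  case (add p q)
  then show ?case by (simp add: euler_add algebra_simps)
qed

lemma grammar_derivation_exists:
  "\<exists>D :: 'c::comm_ring_1 laurent \<Rightarrow> 'c laurent. is_derivation D \<and> obeys_grammar D"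
proof -
  define D :: "'c laurent \<Rightarrow> 'c laurent" where
    "D = (\<lambda>p. euler A p * (lvar X * lvar V) + (euler X p + euler Z p) * (lvar V * lvar Z)
            + (euler V p + euler U p) * (lvar U * lvar V * lvar Z))"
  have const: "euler g (lconst c) = 0" for g and c :: 'c
    by (simp add: lconst_def euler_single)
  have var: "euler g (lvar h) = (if g = h then lvar h else 0 :: 'c laurent)" for g h
    by (auto simp: lvar_def lpow_def euler_single lookup_single when_def)
  have "is_derivation D"
    unfolding is_derivation_def D_def by (simp add: euler_add euler_mult const algebra_simps)
  moreover have "obeys_grammar D"
    unfolding obeys_grammar_def D_def by (simp add: var algebra_simps power2_eq_square)
  ultimately show ?thesis by blast
qed

lemma grammar_derivation_unique:
  fixes D E :: "'c::comm_ring_1 laurent \<Rightarrow> 'c laurent"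
  assumes "is_derivation D" "obeys_grammar D" "is_derivation E" "obeys_grammar E"
  shows "D = E"
proof -
  have D: "D (p + q) = D p + D q" "D (lconst c * p) = lconst c * D p"
      "D (p * q) = D p * q + p * D q" for p q c
    using assms(1) by (auto simp: is_derivation_def)
  have E: "E (p + q) = E p + E q" "E (lconst c * p) = lconst c * E p"
      "E (p * q) = E p * q + p * E q" for p q c
    using assms(3) by (auto simp: is_derivation_def)
  have one: "D 1 = 0" "E 1 = 0" using D(3)[of 1 1] E(3)[of 1 1] by simp_all
  have var: "D (lpow g 1) = E (lpow g 1)" for g
    using assms(2,4) by (cases g) (auto simp: obeys_grammar_def lvar_def)
  have inv: "D q = E q" if "D p = E p" "p * q = 1" for p q
  proof -
    have "p * D q = p * E q"
      using D(3)[of p q] E(3)[of p q] one that by (metis add_left_cancel)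
    then have "q * (p * D q) = q * (p * E q)" by simp
    then show ?thesis using that(2) by (simp add: mult.assoc[symmetric] mult.commute[of q p])
  qed
  have minus: "D (lpow g (-1)) = E (lpow g (-1))" for g
    by (rule inv[OF var[of g]]) (simp add: lpow_add[symmetric] lpow_0)
  have pow: "D (lpow g e) = E (lpow g e)" for g e
  proof (induction e rule: int_induct[where k = 0])
    case base
    show ?case using one by (simp add: lpow_0)
  next
    case (step1 i)
    then show ?case using var[of g] by (simp add: lpow_add D E)
  next
    case (step2 i)
    have "(lpow g (i - 1) :: 'c laurent) = lpow g i * lpow g (-1)"
      by (simp add: lpow_add[symmetric])
    then show ?case using step2 minus[of g] by (simp add: D E)
  qed
  have mono: "D (Poly_Mapping.single m 1) = E (Poly_Mapping.single m 1)" for m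
  proof (induction m rule: poly_mapping_single_induct)
    case (single g e)
    show ?case using pow[of g e] by (simp add: lpow_def)
  next
    case (add m m')
    then show ?case
      using D(3)[of "Poly_Mapping.single m 1" "Poly_Mapping.single m' 1"]
        E(3)[of "Poly_Mapping.single m 1" "Poly_Mapping.single m' 1"]
      by (simp add: mult_single)
  qed
  have "D p = E p" for p
  proof (induction p rule: poly_mapping_single_induct)
    case (single m c)
    have "Poly_Mapping.single m c = lconst c * Poly_Mapping.single m 1"
      by (simp add: lconst_def mult_single)
    then show ?case using mono[of m] by (simp add: D(2) E(2))
  next
    case (add p q)
    then show ?case by (simp add: D E)
  qed
  then show ?thesis by blast
qed

end

theory Submission
  imports Defs
begin

text \<open>
  Since \<open>D\<close> multiplies the monomial \<open>a v^n x^d z^(n-d) u^k\<close> by \<open>v (x + n z + (n + k) u z)\<close>, it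
  suffices that the trees on \<open>{1..n+2}\<close> arise from those on \<open>{1..n+1}\<close> in a matching way. If the
  largest vertex \<open>m\<close> is a leaf, removing it leaves a tree with the same improper edges; attaching
  \<open>m\<close> to the root accounts for \<open>x\<close> and to another vertex for \<open>n z\<close>.

  Otherwise all edges below \<open>m\<close> are improper. Let \<open>p\<close> be the child of \<open>m\<close> whose least descendant is
  largest; delete \<open>m\<close>, attach \<open>p\<close> to the parent of \<open>m\<close> and the other children \<open>S\<close> of \<open>m\<close> to \<open>p\<close>.
  The edges from \<open>p\<close> to \<open>S\<close> are improper because the least descendants of \<open>S\<close> lie below that of \<open>p\<close>,
  so exactly one improper edge is lost. Conversely, \<open>S\<close> is an initial segment (by least descendant)
  of the improper children of the non-root vertex \<open>p\<close>; there are \<open>1 + c\<close> such segments if \<open>p\<close> has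
  \<open>c\<close> improper children, hence \<open>n + k\<close> choices of \<open>(p, S)\<close> in total.
\<close>

section \<open>Rooted trees as edge sets\<close>

lemma is_rooted_treeI:
  assumes "T \<subseteq> W \<times> W" "r \<in> W" "\<And>i. (i, r) \<notin> T"
    and "\<And>i i' j. (i, j) \<in> T \<Longrightarrow> (i', j) \<in> T \<Longrightarrow> i = i'"
    and "\<And>j. j \<in> W \<Longrightarrow> (r, j) \<in> T\<^sup>*"
  shows "is_rooted_tree W r T"
proof -
  have "\<exists>i. (i, j) \<in> T" if "j \<in> W" "j \<noteq> r" for j
    using assms(5)[OF that(1)] that(2) by (metis rtranclE)
  then have "\<exists>!i. (i, j) \<in> T" if "j \<in> W - {r}" for j
    using that assms(4) by blast
  then show ?thesis
    unfolding is_rooted_tree_def using assms(1,2,3,5) by simp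
qed

lemma rooted_treeD:
  assumes "is_rooted_tree W r T"
  shows "(i, j) \<in> T \<Longrightarrow> i \<in> W" "(i, j) \<in> T \<Longrightarrow> j \<in> W" "(i, j) \<in> T \<Longrightarrow> j \<noteq> r" "r \<in> W"
    and "j \<in> W \<Longrightarrow> (r, j) \<in> T\<^sup>*"
    and "j \<in> W \<Longrightarrow> j \<noteq> r \<Longrightarrow> \<exists>i. (i, j) \<in> T"
  using assms unfolding is_rooted_tree_def by auto

lemma rooted_tree_parent_unique:
  assumes "is_rooted_tree W r T" "(i, j) \<in> T" "(i', j) \<in> T"
  shows "i = i'"
  using assms rooted_treeD(2,3)[OF assms(1)] unfolding is_rooted_tree_def by blast

lemma rooted_tree_parent_rtrancl:
  assumes "is_rooted_tree W r T" "(i, j) \<in> T" "(a, j) \<in> T\<^sup>*" "a \<noteq> j"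
  shows "(a, i) \<in> T\<^sup>*"
  using assms(3,4) rooted_tree_parent_unique[OF assms(1,2)] by (metis rtranclE)

text \<open>A cycle through a vertex enters it by its unique parent, so the parent lies on a cycle
  too. Induction along the path from the root moves the cycle up to \<open>r\<close>, which has no
  parent.\<close>

lemma rooted_tree_acyclic:
  assumes T: "is_rooted_tree W r T"
  shows "(x, x) \<notin> T\<^sup>+"
proof
  assume *: "(x, x) \<in> T\<^sup>+"
  then have "x \<in> W" using rooted_treeD(1)[OF T] by (metis tranclD)
  from rooted_treeD(5)[OF T this] * show False
  proof (induction rule: rtrancl_induct)
    case base
    then show ?case using rooted_treeD(3)[OF T] by (metis tranclE)
  next
    case (step y z)
    from step.prems obtain a where a: "(z, a) \<in> T\<^sup>*" "(a, z) \<in> T"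
      by (meson tranclD2)
    then have "a = y" using rooted_tree_parent_unique[OF T] step(2) by blast
    then have "(y, y) \<in> T\<^sup>+" using a(1) step(2) by (meson rtrancl_into_trancl2)
    then show ?case by (rule step.IH)
  qed
qed

lemma rooted_tree_irrefl:
  assumes "is_rooted_tree W r T" "(i, j) \<in> T"
  shows "i \<noteq> j"
  using rooted_tree_acyclic[OF assms(1)] assms(2) by blast

lemma descendants_self [simp]: "x \<in> descendants T x"
  by (simp add: descendants_def)

lemma descendants_unfold: "descendants T x = insert x (\<Union>c \<in> {c. (x, c) \<in> T}. descendants T c)"
  unfolding descendants_def by (auto elim: converse_rtranclE intro: converse_rtrancl_into_rtrancl)

lemma rooted_tree_descendants_subset:
  assumes "is_rooted_tree W r T" "x \<in> W"
  shows "descendants T x \<subseteq> W"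
proof
  fix d assume "d \<in> descendants T x"
  then have "(x, d) \<in> T\<^sup>*" by (simp add: descendants_def)
  then show "d \<in> W" using assms(2) rooted_treeD(2)[OF assms(1)] by (metis rtranclE)
qed

text \<open>Unique parents make the converse relation single-valued, hence confluent: a common
  descendant makes one sibling a descendant of the other. It is then a descendant of the other's
  child only through \<open>p\<close>, which closes a cycle.\<close>

lemma rooted_tree_siblings_disjoint:
  assumes T: "is_rooted_tree W r T" and e: "(p, j) \<in> T" "(p, j') \<in> T" and ne: "j \<noteq> j'"
  shows "descendants T j \<inter> descendants T j' = {}"
proof -
  have no: False if "(a, b) \<in> T\<^sup>*" "a \<noteq> b" "(p, a) \<in> T" "(p, b) \<in> T" for a b
    using rooted_tree_parent_rtrancl[OF T that(4,1,2)] that(3) rooted_tree_acyclic[OF T]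
    by (metis rtrancl_into_trancl1)
  have sv: "single_valued (T\<inverse>)"
    using rooted_tree_parent_unique[OF T] by (auto simp: single_valued_def)
  show ?thesis
  proof (rule ccontr)
    assume "descendants T j \<inter> descendants T j' \<noteq> {}"
    then obtain d where "(d, j) \<in> (T\<inverse>)\<^sup>*" "(d, j') \<in> (T\<inverse>)\<^sup>*"
      by (auto simp: descendants_def rtrancl_converse)
    from single_valued_confluent[OF sv this] show False
      using no[of j j'] no[of j' j] e ne by (auto simp: rtrancl_converse)
  qed
qed

section \<open>Least descendants and improper edges\<close>

definition min_desc :: "(nat \<times> nat) set \<Rightarrow> nat \<Rightarrow> nat" where
  "min_desc T j = (LEAST d. d \<in> descendants T j)"

lemma min_desc_in: "min_desc T j \<in> descendants T j"
  unfolding min_desc_def by (rule LeastI[of _ j]) simp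

lemma min_desc_le: "d \<in> descendants T j \<Longrightarrow> min_desc T j \<le> d"
  unfolding min_desc_def by (rule Least_le)

lemma less_min_desc_iff: "a < min_desc T x \<longleftrightarrow> (\<forall>d \<in> descendants T x. a < d)"
  using min_desc_in min_desc_le by (meson less_le_trans)

text \<open>Working with strict lower bounds turns the recursion over the children into a
  conjunction and avoids a minimum over a possibly empty set of children.\<close>

lemma less_min_desc_unfold:
  "a < min_desc T x \<longleftrightarrow> a < x \<and> (\<forall>c. (x, c) \<in> T \<longrightarrow> a < min_desc T c)"
  unfolding less_min_desc_iff by (subst descendants_unfold) auto

lemma improper_edges_iff: "(i, j) \<in> improper_edges T \<longleftrightarrow> (i, j) \<in> T \<and> min_desc T j < i"
  unfolding improper_edges_def using min_desc_in[of T j] min_desc_le[of _ T j]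
  by (auto intro: le_less_trans)

lemma min_desc_inj_on_siblings:
  assumes "is_rooted_tree W r T"
  shows "inj_on (min_desc T) {c. (p, c) \<in> T}"
  using rooted_tree_siblings_disjoint[OF assms] min_desc_in
  by (intro inj_onI) (metis disjoint_iff mem_Collect_eq)

text \<open>The subtrees differ at most by \<open>m\<close>, which is never the minimum because
  \<open>x\<close> itself is smaller.\<close>

lemma min_desc_cong_new_max:
  assumes "descendants T' x - {m} = descendants T x" "x < m"
  shows "min_desc T' x = min_desc T x"
proof (rule antisym)
  show "min_desc T' x \<le> min_desc T x"
    using assms(1) min_desc_in[of T x] by (intro min_desc_le) blast
  have "min_desc T' x < m"
    using min_desc_le[of x T' x] assms(2) by simp
  then show "min_desc T x \<le> min_desc T' x"
    using assms(1) min_desc_in[of T' x] by (intro min_desc_le) auto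
qed

text \<open>A nonempty such \<open>S\<close> is determined by its element \<open>q\<close> with the
  largest key: it consists of all \<open>j\<close> in \<open>K\<close> with
  \<open>b j <= b q\<close>, and any \<open>q\<close> with \<open>b q < p\<close> may occur. The
  empty set accounts for the \<open>Suc\<close>.\<close>

lemma card_lower_sets:
  fixes b :: "'a \<Rightarrow> 'b::linorder"
  assumes fin: "finite K" and inj: "inj_on b K"
  shows "card {S. S \<subseteq> K \<and> (\<forall>j \<in> S. b j < p \<and> (\<forall>c \<in> K - S. b j < b c))} = Suc (card {q \<in> K. b q < p})"
    (is "card ?L = _")
proof -
  define low where "low = (\<lambda>q. {j \<in> K. b j \<le> b q})"
  have "S \<in> insert {} (low ` {q \<in> K. b q < p})" if "S \<in> ?L" for S
  proof (cases "S = {}")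
    case False
    have "finite S" using that fin finite_subset by blast
    then obtain q where q: "q \<in> S" "\<And>j. j \<in> S \<Longrightarrow> b j \<le> b q"
      using False finite_has_maximal[of "b ` S"] by (metis (no_types, lifting) finite_imageI image_iff
          image_is_empty linear rev_image_eqI)
    have "j \<in> S" if "j \<in> K" "b j \<le> b q" for j
      using \<open>S \<in> ?L\<close> q(1) that leD by blast
    then have "S = low q"
      using that q(2) unfolding low_def by blast
    then show ?thesis using q that by auto
  qed simp
  moreover have "insert {} (low ` {q \<in> K. b q < p}) \<subseteq> ?L"
    by (auto simp: low_def)
  ultimately have "?L = insert {} (low ` {q \<in> K. b q < p})" by blast
  moreover have "{} \<notin> low ` {q \<in> K. b q < p}"
    by (auto simp: low_def)
  moreover have "inj_on low {q \<in> K. b q < p}"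
  proof (rule inj_onI)
    fix q q' assume *: "q \<in> {q \<in> K. b q < p}" "q' \<in> {q \<in> K. b q < p}" "low q = low q'"
    then have "q \<in> low q'" "q' \<in> low q" by (auto simp: low_def)
    then have "b q = b q'" by (auto simp: low_def intro: antisym)
    then show "q = q'" using * inj by (auto dest: inj_onD)
  qed
  ultimately show ?thesis using fin by (simp add: card_image)
qed

section \<open>Inserting a new largest vertex\<close>

text \<open>
  The vertex \<open>m\<close> is put between \<open>p\<close> and its parent and adopts the children \<open>S\<close> of \<open>p\<close>;
  \<open>contract m p\<close> undoes this.
\<close>

definition insert_above :: "'a \<Rightarrow> 'a \<Rightarrow> 'a set \<Rightarrow> ('a \<times> 'a) set \<Rightarrow> ('a \<times> 'a) set" where
  "insert_above m p S T =
     {(a, b) \<in> T. b \<noteq> p \<and> b \<notin> S} \<union> {(i, m) | i. (i, p) \<in> T} \<union> {m} \<times> insert p S"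

definition contract :: "'a \<Rightarrow> 'a \<Rightarrow> ('a \<times> 'a) set \<Rightarrow> ('a \<times> 'a) set" where
  "contract m p T =
     {(a, b) \<in> T. a \<noteq> m \<and> b \<noteq> m} \<union> {(i, p) | i. (i, m) \<in> T} \<union> {p} \<times> ({j. (m, j) \<in> T} - {p})"

text \<open>Replacing each visit to \<open>m\<close> by a visit to \<open>i\<close>, the parent of
  \<open>p\<close>, turns a path of the larger tree into one of \<open>T\<close>: the edge from
  \<open>m\<close> to \<open>p\<close> becomes \<open>(i, p)\<close>, and an edge from
  \<open>m\<close> into \<open>S\<close> becomes a detour through \<open>p\<close>. The case
  distinction on \<open>y\<close> is the induction invariant.\<close>

lemma contract_rtrancl:
  assumes "(x, y) \<in> (insert_above m p S T)\<^sup>*" "x \<noteq> m" "(i, p) \<in> T" "S \<subseteq> {j. (p, j) \<in> T}"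
    and "\<And>a. (a, p) \<in> T \<Longrightarrow> a = i" "\<And>a b. (a, b) \<in> T \<Longrightarrow> a \<noteq> m \<and> b \<noteq> m"
  shows "if y = m then (x, i) \<in> T\<^sup>* else (x, y) \<in> T\<^sup>*"
  using assms(1)
proof (induction rule: rtrancl_induct)
  case base
  then show ?case using assms(2) by simp
next
  case (step y z)
  from step(2) consider "(y, z) \<in> T" | "z = m" "(y, p) \<in> T" | "y = m" "z = p" | "y = m" "z \<in> S"
    by (auto simp: insert_above_def)
  then show ?case
  proof cases
    case 1
    then show ?thesis using step(3) assms(6)[of y z] by auto
  next
    case 2
    then show ?thesis using step(3) assms(5,6) by auto
  next
    case 3
    then show ?thesis using step(3) assms(3,6) by auto
  next
    case 4
    then have "(x, i) \<in> T\<^sup>*" "(p, z) \<in> T" using step(3) assms(4) by auto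
    then show ?thesis using assms(3) assms(6)[of p z] by auto
  qed
qed

lemma insert_above_rtrancl:
  assumes "(x, y) \<in> T\<^sup>*" "x \<noteq> p" "x \<noteq> m" "S \<subseteq> {j. (p, j) \<in> T}"
    and un: "\<And>a a' b. (a, b) \<in> T \<Longrightarrow> (a', b) \<in> T \<Longrightarrow> a = a'" and mT: "\<And>a b. (a, b) \<in> T \<Longrightarrow> a \<noteq> m \<and> b \<noteq> m"
  shows "(x, y) \<in> (insert_above m p S T)\<^sup>*"
  using assms(1)
proof (induction rule: rtrancl_induct)
  case (step y z)
  let ?T = "insert_above m p S T"
  consider "z \<noteq> p" "z \<notin> S" | "z = p" | "z \<in> S" by blast
  then show ?case
  proof cases
    case 1
    then have "(y, z) \<in> ?T" using step(2) by (auto simp: insert_above_def)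
    then show ?thesis using step(3) by simp
  next
    case 2
    then have "(y, m) \<in> ?T" "(m, z) \<in> ?T" using step(2) by (auto simp: insert_above_def)
    then show ?thesis using step(3) by (meson rtrancl.rtrancl_into_rtrancl)
  next
    case 3
    then have "y = p" using step(2) assms(4) un by blast
    moreover have "a = m" if "(a, p) \<in> ?T" for a
      using that mT[of _ p] assms(4) step(2) \<open>y = p\<close> by (auto simp: insert_above_def)
    \<comment> \<open>Since \<open>x\<close> differs from \<open>p\<close>, the path to
      \<open>p\<close> has a last edge, and this edge comes from \<open>m\<close>. From
      \<open>m\<close> the vertex \<open>z\<close> is reached directly.\<close>
    ultimately have "(x, m) \<in> ?T\<^sup>*" using step(3) assms(2) by (metis rtranclE)
    moreover have "(m, z) \<in> ?T" using 3 by (auto simp: insert_above_def)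
    ultimately show ?thesis by simp
  qed
qed simp

text \<open>
  The sets \<open>S\<close> for which, after \<open>insert_above m p S\<close>, the vertex \<open>p\<close> is the child of \<open>m\<close> with the
  largest least descendant, so that \<open>p\<close> can be recovered.
\<close>

definition lower_children :: "(nat \<times> nat) set \<Rightarrow> nat \<Rightarrow> nat set set" where
  "lower_children T p = {S. S \<subseteq> {c. (p, c) \<in> T} \<and>
     (\<forall>j \<in> S. min_desc T j < p \<and> (\<forall>c \<in> {c. (p, c) \<in> T} - S. min_desc T j < min_desc T c))}"

section \<open>Finiteness and counting of the admissible sets\<close>

lemma finite_rooted_tree:
  assumes "is_rooted_tree W r T" "finite W"
  shows "finite T"
  using assms unfolding is_rooted_tree_def by (metis finite_SigmaI finite_subset)

lemma finite_rooted_trees: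
  assumes "finite W"
  shows "finite {T. is_rooted_tree W r T}"
  by (rule finite_subset[of _ "Pow (W \<times> W)"]) (use assms in \<open>auto simp: is_rooted_tree_def\<close>)

text \<open>An edge is determined by its child. Counting children instead of edges suits the
  insertion of \<open>m\<close>, which changes the parents of vertices whose edges stay
  improper.\<close>

lemma card_Range_improper_edges:
  assumes "is_rooted_tree W r T"
  shows "card (Range (improper_edges T)) = card (improper_edges T)"
proof -
  have "inj_on snd (improper_edges T)"
    using rooted_tree_parent_unique[OF assms] by (auto simp: inj_on_def improper_edges_def)
  then show ?thesis by (simp add: Range_snd card_image)
qed

lemma finite_improper_edges: "finite T \<Longrightarrow> finite (improper_edges T)"
  unfolding improper_edges_def by (rule finite_subset[of _ T]) auto

lemma finite_children:
  assumes "finite T"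
  shows "finite {c. (p, c) \<in> T}"
  by (rule finite_subset[of _ "snd ` T"]) (use assms in force)+

lemma card_lower_children:
  assumes T: "is_rooted_tree W r T" and fin: "finite W"
  shows "card (lower_children T p) = Suc (card {q. (p, q) \<in> improper_edges T})"
proof -
  have "{q. (p, q) \<in> improper_edges T} = {q \<in> {c. (p, c) \<in> T}. min_desc T q < p}"
    by (auto simp: improper_edges_iff)
  then show ?thesis
    unfolding lower_children_def
    using card_lower_sets[OF finite_children[OF finite_rooted_tree[OF T fin]] min_desc_inj_on_siblings[OF T]]
    by simp
qed

text \<open>Each non-root vertex contributes 1 plus the number of its improper edges. The root has
  none, being the least label, so summing over the other vertices counts every improper edge
  once.\<close>

lemma sum_card_lower_children:
  assumes T: "is_rooted_tree W r T" and fin: "finite W" and min: "\<And>w. w \<in> W \<Longrightarrow> r \<le> w"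
  shows "(\<Sum>p \<in> W - {r}. card (lower_children T p)) = card W - 1 + card (improper_edges T)"
proof -
  have Sigma: "improper_edges T = (SIGMA p:W - {r}. {q. (p, q) \<in> improper_edges T})"
  proof -
    have "p \<in> W - {r}" if "(p, q) \<in> improper_edges T" for p q
    proof -
      have e: "(p, q) \<in> T" "min_desc T q < p" using that by (auto simp: improper_edges_iff)
      have "min_desc T q \<in> W"
        using rooted_tree_descendants_subset[OF T rooted_treeD(2)[OF T e(1)]] min_desc_in by blast
      then show ?thesis using e min rooted_treeD(1)[OF T e(1)] by fastforce
    qed
    then show ?thesis by auto
  qed
  have "card (improper_edges T) = (\<Sum>p \<in> W - {r}. card {q. (p, q) \<in> improper_edges T})"
    using fin finite_children[OF finite_improper_edges[OF finite_rooted_tree[OF T fin]]]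
    by (subst Sigma, intro card_SigmaI) auto
  then show ?thesis
    using card_lower_children[OF T fin] rooted_treeD(4)[OF T] fin
    by (simp add: sum_Suc)
qed

context
  fixes W :: "nat set" and r :: nat and T :: "(nat \<times> nat) set" and m :: nat
  assumes T: "is_rooted_tree W r T" and m: "\<forall>w \<in> W. w < m"
begin

lemma new_max_notin: "m \<notin> W" "(m, b) \<notin> T" "(a, m) \<notin> T"
  using rooted_treeD(1,2)[OF T] m by blast+

lemma new_max_isolated: "(m, y) \<in> T\<^sup>* \<longleftrightarrow> y = m"
  using new_max_notin by (metis converse_rtranclE rtrancl.rtrancl_refl)

section \<open>Attaching the largest vertex as a leaf\<close>

context
  fixes i assumes i: "i \<in> W"
begin

lemma is_rooted_tree_insert_leaf: "is_rooted_tree (insert m W) r (insert (i, m) T)"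
proof (rule is_rooted_treeI)
  show "insert (i, m) T \<subseteq> insert m W \<times> insert m W"
    using i rooted_treeD(1,2)[OF T] by auto
  show "(r, j) \<in> (insert (i, m) T)\<^sup>*" if "j \<in> insert m W" for j
    using that rooted_treeD(5)[OF T] i by (auto simp: rtrancl_insert)
next
  show "r \<in> insert m W" using rooted_treeD(4)[OF T] by simp
  show "(a, r) \<notin> insert (i, m) T" for a
    using rooted_treeD(3,4)[OF T] new_max_notin by auto
  show "a = a'" if "(a, b) \<in> insert (i, m) T" "(a', b) \<in> insert (i, m) T" for a a' b
    using that new_max_notin rooted_tree_parent_unique[OF T] by auto
qed

lemma descendants_insert_leaf: "x \<in> W \<Longrightarrow> descendants (insert (i, m) T) x - {m} = descendants T x"
  using rooted_tree_descendants_subset[OF T] m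
  by (fastforce simp: descendants_def rtrancl_insert new_max_isolated)

text \<open>No old vertex changes its least descendant, and the new edge is proper because
  \<open>m\<close> is its own only descendant and exceeds \<open>i\<close>.\<close>

lemma improper_edges_insert_leaf: "improper_edges (insert (i, m) T) = improper_edges T"
proof -
  have "min_desc (insert (i, m) T) x = min_desc T x" if "x \<in> W" for x
    using min_desc_cong_new_max descendants_insert_leaf that m by blast
  moreover have "descendants (insert (i, m) T) m = {m}"
    using bspec[OF m i] by (auto simp: descendants_def rtrancl_insert new_max_isolated)
  then have "min_desc (insert (i, m) T) m = m"
    using min_desc_in by blast
  ultimately show ?thesis
    using bspec[OF m i] rooted_treeD(2)[OF T] by (auto simp: improper_edges_iff set_eq_iff)
qed

lemma num_children_insert_leaf:
  assumes "finite T"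
  shows "num_children (insert (i, m) T) r = num_children T r + (if i = r then 1 else 0)"
proof -
  have "{j. (r, j) \<in> insert (i, m) T} = (if i = r then insert m else id) {j. (r, j) \<in> T}"
    by auto
  moreover have "m \<notin> {j. (r, j) \<in> T}" using new_max_notin by blast
  ultimately show ?thesis
    using finite_children[OF assms] by (simp add: num_children_def)
qed

end

section \<open>Inserting the largest vertex above \<open>p\<close>\<close>

context
  fixes p S assumes p: "p \<in> W" "p \<noteq> r" and S: "S \<subseteq> {c. (p, c) \<in> T}"
begin

lemma insert_above_distinct: "p \<notin> S" "m \<notin> S" "p \<noteq> m" "r \<noteq> m" "r \<notin> S"
  using S rooted_tree_irrefl[OF T] p(1) rooted_treeD(3,4)[OF T] new_max_notin by blast+

lemma insert_above_iff:
  "(a, b) \<in> insert_above m p S T \<longleftrightarrow> (a, b) \<in> T \<and> b \<noteq> p \<and> b \<notin> S \<or> b = m \<and> (a, p) \<in> T \<or> a = m \<and> (b = p \<or> b \<in> S)"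
  by (auto simp: insert_above_def)

lemma insert_above_mono_rtrancl:
  "(x, y) \<in> T\<^sup>* \<Longrightarrow> x \<noteq> p \<Longrightarrow> x \<noteq> m \<Longrightarrow> (x, y) \<in> (insert_above m p S T)\<^sup>*"
  by (rule insert_above_rtrancl) (use S rooted_tree_parent_unique[OF T] new_max_notin in auto)

lemma insert_above_rtranclD:
  "(x, y) \<in> (insert_above m p S T)\<^sup>* \<Longrightarrow> x \<noteq> m \<Longrightarrow> y \<noteq> m \<Longrightarrow> (x, y) \<in> T\<^sup>*"
proof -
  assume *: "(x, y) \<in> (insert_above m p S T)\<^sup>*" "x \<noteq> m" "y \<noteq> m"
  obtain i where i: "(i, p) \<in> T" using rooted_treeD(6)[OF T p] by blast
  from contract_rtrancl[OF *(1,2) i S] rooted_tree_parent_unique[OF T _ i] new_max_notin *(3)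
  show "(x, y) \<in> T\<^sup>*" by auto
qed

lemma is_rooted_tree_insert_above: "is_rooted_tree (insert m W) r (insert_above m p S T)"
proof (rule is_rooted_treeI)
  show "insert_above m p S T \<subseteq> insert m W \<times> insert m W"
    using p S rooted_treeD(1,2)[OF T] by (auto simp: insert_above_def)
  show "r \<in> insert m W" using rooted_treeD(4)[OF T] by simp
  show "(i, r) \<notin> insert_above m p S T" for i
    using insert_above_distinct p rooted_treeD(3)[OF T] by (auto simp: insert_above_iff)
  show "i = i'" if "(i, j) \<in> insert_above m p S T" "(i', j) \<in> insert_above m p S T" for i i' j
    using that insert_above_distinct new_max_notin
    by (auto simp: insert_above_iff dest: rooted_tree_parent_unique[OF T])
  show "(r, j) \<in> (insert_above m p S T)\<^sup>*" if "j \<in> insert m W" for j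
  proof -
    have *: "(r, w) \<in> (insert_above m p S T)\<^sup>*" if "w \<in> W" for w
      using insert_above_mono_rtrancl rooted_treeD(5)[OF T that] p insert_above_distinct by blast
    obtain i where i: "(i, p) \<in> T" using rooted_treeD(6)[OF T p] by blast
    then have "(i, m) \<in> insert_above m p S T" "i \<in> W" using rooted_treeD(1)[OF T] by (auto simp: insert_above_iff)
    then have "(r, m) \<in> (insert_above m p S T)\<^sup>*" using * by (meson rtrancl.rtrancl_into_rtrancl)
    then show ?thesis using * that by blast
  qed
qed

text \<open>Only \<open>p\<close> loses descendants, namely the subtrees at \<open>S\<close>; any
  other old vertex can at most gain \<open>m\<close>.\<close>

lemma descendants_insert_above:
  assumes "x \<in> W" "x \<noteq> p"
  shows "descendants (insert_above m p S T) x - {m} = descendants T x"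
proof -
  have "x \<noteq> m" "m \<notin> descendants T x"
    using new_max_notin assms(1) rooted_tree_descendants_subset[OF T assms(1)] by auto
  then show ?thesis
    using assms(2) insert_above_mono_rtrancl[of x] insert_above_rtranclD[of x]
    by (auto simp: descendants_def)
qed

lemma min_desc_insert_above: "x \<in> W \<Longrightarrow> x \<noteq> p \<Longrightarrow> min_desc (insert_above m p S T) x = min_desc T x"
  using min_desc_cong_new_max descendants_insert_above m by blast

lemma less_min_desc_insert_above:
  "a < min_desc (insert_above m p S T) p \<longleftrightarrow> a < p \<and> (\<forall>c \<in> {c. (p, c) \<in> T} - S. a < min_desc T c)"
proof -
  have "(p, c) \<in> insert_above m p S T \<longleftrightarrow> (p, c) \<in> T \<and> c \<notin> S" for c
    using insert_above_distinct rooted_tree_irrefl[OF T] by (auto simp: insert_above_iff)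
  moreover have "min_desc (insert_above m p S T) c = min_desc T c" if "(p, c) \<in> T" for c
    using min_desc_insert_above rooted_treeD(2)[OF T that] rooted_tree_irrefl[OF T that] by auto
  ultimately show ?thesis
    by (subst less_min_desc_unfold) auto
qed

text \<open>The two inequalities defining \<open>lower_children\<close> say together that
  \<open>min_desc T j\<close> is below the least descendant that \<open>p\<close> has after giving
  up \<open>S\<close>. Thus membership can be read off from the new tree alone.\<close>

lemma lower_children_iff:
  "S \<in> lower_children T p \<longleftrightarrow>
    (\<forall>j \<in> S. min_desc (insert_above m p S T) j < min_desc (insert_above m p S T) p)"
proof -
  have "min_desc (insert_above m p S T) j = min_desc T j" if "j \<in> S" for j
    using min_desc_insert_above that S insert_above_distinct rooted_treeD(2)[OF T] by blast
  then show ?thesis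
    using S by (simp add: lower_children_def less_min_desc_insert_above)
qed

lemma children_new_max_insert_above: "{c. (m, c) \<in> insert_above m p S T} = insert p S"
  using new_max_notin by (auto simp: insert_above_iff)

lemma contract_insert_above: "contract m p (insert_above m p S T) = T"
proof -
  have "(a, b) \<in> contract m p (insert_above m p S T) \<longleftrightarrow> (a, b) \<in> T" for a b
    unfolding contract_def using S insert_above_distinct new_max_notin rooted_tree_parent_unique[OF T]
    by (auto simp: insert_above_iff)
  then show ?thesis by auto
qed

text \<open>If \<open>p\<close> is a child of the root, \<open>m\<close> takes its place; otherwise
  the children of the root stay the same.\<close>

lemma num_children_insert_above:
  assumes "finite T"
  shows "num_children (insert_above m p S T) r = num_children T r"
proof (cases "(r, p) \<in> T")
  case True
  have "{j. (r, j) \<in> insert_above m p S T} = insert m ({j. (r, j) \<in> T} - {p})"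
    using True insert_above_distinct p rooted_tree_parent_unique[OF T] S by (auto simp: insert_above_iff)
  moreover have "m \<notin> {j. (r, j) \<in> T}" using new_max_notin by blast
  ultimately show ?thesis
    using True finite_children[OF assms, of r] card_Suc_Diff1[of "{j. (r, j) \<in> T}" p]
    by (simp add: num_children_def)
next
  case False
  have "{j. (r, j) \<in> insert_above m p S T} = {j. (r, j) \<in> T}"
    using False insert_above_distinct p rooted_tree_parent_unique[OF T] S by (auto simp: insert_above_iff)
  then show ?thesis by (simp add: num_children_def)
qed

text \<open>The vertex \<open>m\<close> now heads the former subtree of \<open>p\<close>, to which
  it adds only its own, larger label. Equality is derived from equal strict lower bounds.\<close>

lemma min_desc_new_max_insert_above: "min_desc (insert_above m p S T) m = min_desc T p"
proof -
  have S': "min_desc (insert_above m p S T) c = min_desc T c" if "c \<in> S" for c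
    using min_desc_insert_above that S insert_above_distinct rooted_treeD(2)[OF T] by blast
  have "a < min_desc (insert_above m p S T) m \<longleftrightarrow> a < min_desc T p" for a
  proof -
    have "a < min_desc (insert_above m p S T) m \<longleftrightarrow>
        a < m \<and> (\<forall>c \<in> insert p S. a < min_desc (insert_above m p S T) c)"
      using children_new_max_insert_above by (subst less_min_desc_unfold) blast
    also have "\<dots> \<longleftrightarrow> a < p \<and> (\<forall>c \<in> {c. (p, c) \<in> T}. a < min_desc T c)"
      using S S' less_min_desc_insert_above bspec[OF m p(1)] by auto
    finally show ?thesis by (subst (2) less_min_desc_unfold) simp
  qed
  then show ?thesis by (metis less_irrefl linorder_neqE_nat)
qed

text \<open>Compare the children of improper edges. Those in \<open>S\<close> are improper before
  and after, the edge \<open>(m, p)\<close> is always improper, the edge into \<open>m\<close>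
  inherits the status of the old edge into \<open>p\<close>, and all others keep theirs.\<close>

lemma card_improper_edges_insert_above:
  assumes fin: "finite T" and low: "S \<in> lower_children T p"
  shows "card (improper_edges (insert_above m p S T)) = Suc (card (improper_edges T))"
proof -
  let ?I = "Range (improper_edges T)" and ?I' = "Range (improper_edges (insert_above m p S T))"
  have low': "c \<in> ?I" if "c \<in> S" for c
    using that low S by (auto simp: lower_children_def improper_edges_iff Range_iff)
  have lt: "min_desc (insert_above m p S T) b < m" if "b \<in> insert p S" for b
  proof -
    have "b \<in> W" using that p(1) S rooted_treeD(2)[OF T] by blast
    then show ?thesis using min_desc_le[of b "insert_above m p S T" b] bspec[OF m, of b] by simp
  qed
  have "b \<in> ?I' \<longleftrightarrow> b \<in> ?I \<or> b = p \<or> b = m \<and> p \<in> ?I" for b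
  proof -
    consider "b = m" | "b = p" | "b \<in> S" | "b \<noteq> m" "b \<noteq> p" "b \<notin> S" by blast
    then show ?thesis
    proof cases
      case 1
      then show ?thesis
        using new_max_notin insert_above_distinct
        by (auto simp: Range_iff improper_edges_iff insert_above_iff min_desc_new_max_insert_above)
    next
      case 2
      then show ?thesis
        using lt[of p] by (auto simp: Range_iff improper_edges_iff insert_above_iff)
    next
      case 3
      then show ?thesis
        using lt[of b] low' insert_above_distinct by (auto simp: Range_iff improper_edges_iff insert_above_iff)
    next
      case 4
      have "min_desc (insert_above m p S T) b = min_desc T b" if "(a, b) \<in> T" for a
        using min_desc_insert_above rooted_treeD(2)[OF T that] 4 by blast
      then show ?thesis
        using 4 by (auto simp: Range_iff improper_edges_iff insert_above_iff)
    qed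
  qed
  \<comment> \<open>Exactly one element is new: \<open>m\<close> if \<open>p\<close> was already
    counted, and \<open>p\<close> itself otherwise.\<close>
  then have "?I' = insert (if p \<in> ?I then m else p) ?I" by auto
  moreover have "m \<notin> ?I"
    using new_max_notin by (auto simp: improper_edges_iff)
  moreover have "finite ?I"
    using finite_improper_edges[OF fin] by (simp add: Range_snd)
  ultimately have "card ?I' = Suc (card ?I)" by simp
  then show ?thesis
    using card_Range_improper_edges[OF T] card_Range_improper_edges[OF is_rooted_tree_insert_above]
    by simp
qed

end

end

section \<open>Deleting the largest vertex\<close>

lemma contract_tree:
  assumes T: "is_rooted_tree (insert m W) r T" and m: "m \<notin> W" and r: "r \<in> W"
    and p: "(m, p) \<in> T"
  defines "S \<equiv> {j. (m, j) \<in> T} - {p}"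
  shows "insert_above m p S (contract m p T) = T" and "is_rooted_tree W r (contract m p T)"
    and "S \<subseteq> {c. (p, c) \<in> contract m p T}" and "p \<in> W" "p \<noteq> r"
proof -
  let ?T = "contract m p T"
  note un = rooted_tree_parent_unique[OF T]
  have mr: "m \<notin> W" "m \<noteq> r" using m r by auto
  obtain i where i: "(i, m) \<in> T" using rooted_treeD(6)[OF T, of m] mr by auto
  have im: "(x, m) \<in> T \<longleftrightarrow> x = i" for x using i un[OF _ i] by blast
  have mp: "(x, p) \<in> T \<longleftrightarrow> x = m" for x using p un[OF _ p] by blast
  have mm: "(m, m) \<notin> T" using rooted_tree_irrefl[OF T] by blast
  have W: "a \<in> W \<or> a = m" "b \<in> W \<or> b = m" "b \<noteq> r" if "(a, b) \<in> T" for a b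
    using rooted_treeD(1-3)[OF T that] by auto
  have pm: "p \<noteq> m" "i \<noteq> m" using p i mm by auto
  show pW: "p \<in> W" and pr: "p \<noteq> r" using W[OF p] pm by auto
  have iW: "i \<in> W" using W(1)[OF i] pm by auto
  have iff: "(a, b) \<in> ?T \<longleftrightarrow> (a, b) \<in> T \<and> a \<noteq> m \<and> b \<noteq> m \<or> b = p \<and> a = i \<or> a = p \<and> (m, b) \<in> T \<and> b \<noteq> p" for a b
    by (auto simp: contract_def im)
  show S: "S \<subseteq> {c. (p, c) \<in> ?T}" by (auto simp: S_def iff)
  have "(a, b) \<in> insert_above m p S ?T \<longleftrightarrow> (a, b) \<in> T" for a b
  proof (cases "(m, b) \<in> T")
    case True
    then have "(x, b) \<in> T \<longleftrightarrow> x = m" for x using un[OF _ True] by blast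
    then show ?thesis using True im mp mm pm by (auto simp: insert_above_def iff S_def)
  next
    case False
    then show ?thesis using p im mp mm pm by (auto simp: insert_above_def iff S_def)
  qed
  then show ins: "insert_above m p S ?T = T" by auto
  show "is_rooted_tree W r ?T"
  proof (rule is_rooted_treeI)
    show "?T \<subseteq> W \<times> W"
    proof (rule subrelI)
      fix a b assume "(a, b) \<in> ?T"
      then show "(a, b) \<in> W \<times> W"
        using W(1,2)[of a b] W(2)[of m b] pW iW mm by (auto simp: iff)
    qed
    show "(a, r) \<notin> ?T" for a using W(3) pr by (auto simp: iff)
    show "a = a'" if "(a, b) \<in> ?T" "(a', b) \<in> ?T" for a a' b
    proof -
      consider "b = p" | "b \<noteq> p" "(m, b) \<in> T" | "b \<noteq> p" "(m, b) \<notin> T" by blast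
      then show ?thesis
      proof cases
        case 1
        then show ?thesis using that mp pm by (auto simp: iff)
      next
        case 2
        then have "(x, b) \<in> T \<longleftrightarrow> x = m" for x using un[OF _ 2(2)] by blast
        then show ?thesis using that 2 by (auto simp: iff)
      next
        case 3
        then have "(a, b) \<in> T" "(a', b) \<in> T" using that by (auto simp: iff)
        then show ?thesis by (rule un)
      qed
    qed
    show "(r, j) \<in> ?T\<^sup>*" if "j \<in> W" for j
    proof -
      \<comment> \<open>As \<open>T\<close> is now known to be an insertion into \<open>?T\<close>,
        its paths from the root translate back by \<open>contract_rtrancl\<close>.\<close>
      have "(r, j) \<in> (insert_above m p S ?T)\<^sup>*" using rooted_treeD(5)[OF T] that by (simp add: ins)
      then have "if j = m then (r, i) \<in> ?T\<^sup>* else (r, j) \<in> ?T\<^sup>*"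
        by (rule contract_rtrancl) (use pm mp mm mr S in \<open>auto simp: iff\<close>)
      then show ?thesis using mr that by (auto split: if_splits)
    qed
  qed (rule r)
qed

lemma remove_leaf_tree:
  assumes T: "is_rooted_tree (insert m W) r T" and r: "r \<in> W" and m: "m \<notin> W" and i: "(i, m) \<in> T"
    and leaf: "{c. (m, c) \<in> T} = {}"
  shows "is_rooted_tree W r (T - {(i, m)})" and "i \<in> W"
proof -
  have W: "a \<in> W \<or> a = m" "b \<in> W \<or> b = m" "b \<noteq> r" if "(a, b) \<in> T" for a b
    using rooted_treeD(1-3)[OF T that] by auto
  show "i \<in> W" using W[OF i] i leaf by blast
  show "is_rooted_tree W r (T - {(i, m)})"
  proof (rule is_rooted_treeI)
    show "T - {(i, m)} \<subseteq> W \<times> W"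
    proof (rule subrelI)
      fix a b assume "(a, b) \<in> T - {(i, m)}"
      then have ab: "(a, b) \<in> T" "\<not> (a = i \<and> b = m)" by auto
      have "a \<in> W" using W(1)[OF ab(1)] ab(1) leaf by blast
      moreover have "b \<in> W" using W(2)[OF ab(1)] ab rooted_tree_parent_unique[OF T i] by blast
      ultimately show "(a, b) \<in> W \<times> W" by blast
    qed
    show "(r, j) \<in> (T - {(i, m)})\<^sup>*" if "j \<in> W" for j
    proof -
      have "(r, j) \<in> T\<^sup>*" using rooted_treeD(5)[OF T] that by simp
      then have "j \<noteq> m \<longrightarrow> (r, j) \<in> (T - {(i, m)})\<^sup>*"
      proof (induction rule: rtrancl_induct)
        case (step y z)
        then show ?case using leaf by (auto intro: rtrancl.rtrancl_into_rtrancl)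
      qed simp
      then show ?thesis using that m by blast
    qed
  qed (use r W(3) rooted_tree_parent_unique[OF T] in auto)
qed

section \<open>The recurrence for trees\<close>

text \<open>Adding the edge \<open>(i, m)\<close> is a bijection from pairs of a tree on
  \<open>W\<close> and a vertex \<open>i\<close> onto the trees in which \<open>m\<close> is a
  leaf.\<close>

lemma sum_leaf_trees:
  fixes g :: "(nat \<times> nat) set \<Rightarrow> 'b::comm_monoid_add"
  assumes r: "r \<in> W" and m: "\<forall>w \<in> W. w < m"
  shows "(\<Sum>T | is_rooted_tree (insert m W) r T \<and> {c. (m, c) \<in> T} = {}. g T)
    = (\<Sum>T | is_rooted_tree W r T. \<Sum>i \<in> W. g (insert (i, m) T))"
proof -
  let ?f = "\<lambda>(T, i). insert (i, m) T" and ?P = "{T. is_rooted_tree W r T} \<times> W"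
  have "inj_on ?f ?P"
  proof (rule inj_onI; clarify)
    fix T i T' i'
    assume T: "is_rooted_tree W r T" "is_rooted_tree W r T'" and eq: "insert (i, m) T = insert (i', m) T'"
    have "(a, m) \<notin> T" "(a, m) \<notin> T'" for a using new_max_notin(3) T m by blast+
    with eq show "T = T' \<and> i = i'" by (metis insertI1 insert_ident insert_iff prod.inject)
  qed
  moreover have "?f ` ?P = {T. is_rooted_tree (insert m W) r T \<and> {c. (m, c) \<in> T} = {}}" (is "_ = ?L")
  proof (intro equalityI subsetI)
    fix T' assume "T' \<in> ?f ` ?P"
    then obtain T i where T: "is_rooted_tree W r T" "i \<in> W" "T' = insert (i, m) T" by auto
    then have "{c. (m, c) \<in> T'} = {}" using new_max_notin(2)[OF T(1) m] bspec[OF m T(2)] by auto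
    then show "T' \<in> ?L" using is_rooted_tree_insert_leaf[OF T(1) m T(2)] T(3) by simp
  next
    fix T assume T: "T \<in> ?L"
    have mW: "m \<notin> W" using m by blast
    then obtain i where i: "(i, m) \<in> T" using T rooted_treeD(6)[of "insert m W" r T m] r by blast
    then have "T = ?f (T - {(i, m)}, i)" by auto
    moreover have "(T - {(i, m)}, i) \<in> ?P" using remove_leaf_tree[OF _ r mW i] T by blast
    ultimately show "T \<in> ?f ` ?P" by blast
  qed
  ultimately have "sum g ?L = (\<Sum>(T, i) \<in> ?P. g (insert (i, m) T))"
    using sum.reindex[of ?f ?P g] by (simp add: case_prod_unfold o_def)
  then show ?thesis by (simp add: sum.cartesian_product)
qed

text \<open>The insertion is a bijection from the triples \<open>(T, p, S)\<close>. From its value,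
  \<open>p\<close> is recovered as the child of \<open>m\<close> with the largest least descendant,
  \<open>S\<close> as the set of the other children, and \<open>T\<close> by contraction.\<close>

lemma sum_nonleaf_trees:
  fixes g :: "(nat \<times> nat) set \<Rightarrow> 'b::comm_monoid_add"
  assumes r: "r \<in> W" and m: "\<forall>w \<in> W. w < m"
  shows "(\<Sum>T | is_rooted_tree (insert m W) r T \<and> {c. (m, c) \<in> T} \<noteq> {}. g T)
    = (\<Sum>T | is_rooted_tree W r T. \<Sum>p \<in> W - {r}. \<Sum>S \<in> lower_children T p. g (insert_above m p S T))"
proof -
  have fin: "finite W" using m finite_nat_set_iff_bounded by blast
  let ?f = "\<lambda>(T, p, S). insert_above m p S T"
  let ?P = "SIGMA T:{T. is_rooted_tree W r T}. SIGMA p:W - {r}. lower_children T p"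
  have lowS: "S \<subseteq> {c. (p, c) \<in> T}" if "S \<in> lower_children T p" for T p S
    using that by (simp add: lower_children_def)
  have "inj_on ?f ?P"
  proof (rule inj_onI)
    fix x y assume xy: "x \<in> ?P" "y \<in> ?P" "?f x = ?f y"
    obtain T p S T' p' S' where x: "x = (T, p, S)" and y: "y = (T', p', S')" by (metis surj_pair)
    let ?U = "insert_above m p S T"
    have T: "is_rooted_tree W r T" "p \<in> W" "p \<noteq> r" "S \<in> lower_children T p"
      and T': "is_rooted_tree W r T'" "p' \<in> W" "p' \<noteq> r" "S' \<in> lower_children T' p'"
      and eq: "?U = insert_above m p' S' T'"
      using xy x y by auto
    note A = T(1) m T(2,3) lowS[OF T(4)] and A' = T'(1) m T'(2,3) lowS[OF T'(4)]
    have C: "insert p S = insert p' S'"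
      using children_new_max_insert_above[OF A] children_new_max_insert_above[OF A'] eq by simp
    have lt: "\<forall>j \<in> S. min_desc ?U j < min_desc ?U p" "\<forall>j \<in> S'. min_desc ?U j < min_desc ?U p'"
      using lower_children_iff[OF A] lower_children_iff[OF A'] T(4) T'(4) eq by auto
    \<comment> \<open>Otherwise each of the two lies in the set belonging to the other, so each has
      a smaller least descendant than the other.\<close>
    have "p = p'"
    proof (rule ccontr)
      assume "p \<noteq> p'"
      then have "p' \<in> S" "p \<in> S'" using C by auto
      then show False using lt by fastforce
    qed
    moreover have "S = S'"
      using C insert_above_distinct(1)[OF A] insert_above_distinct(1)[OF A'] \<open>p = p'\<close> by (simp add: insert_ident)
    moreover have "T = T'"
      using contract_insert_above[OF A] contract_insert_above[OF A'] eq \<open>p = p'\<close> by simp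
    ultimately show "x = y" using x y by simp
  qed
  moreover have "?f ` ?P = {T. is_rooted_tree (insert m W) r T \<and> {c. (m, c) \<in> T} \<noteq> {}}" (is "_ = ?N")
  proof (intro equalityI subsetI)
    fix T' assume "T' \<in> ?f ` ?P"
    then obtain T p S where T: "is_rooted_tree W r T" "p \<in> W" "p \<noteq> r" "S \<in> lower_children T p"
      and T': "T' = insert_above m p S T" by auto
    note A = T(1) m T(2,3) lowS[OF T(4)]
    show "T' \<in> ?N"
      using is_rooted_tree_insert_above[OF A] children_new_max_insert_above[OF A] T' by blast
  next
    fix T assume "T \<in> ?N"
    then have T: "is_rooted_tree (insert m W) r T" and ne: "{c. (m, c) \<in> T} \<noteq> {}" by auto
    let ?C = "{c. (m, c) \<in> T}"
    have "finite (min_desc T ` ?C)"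
      using finite_children[OF finite_rooted_tree[OF T]] fin by simp
    from Max_in[OF this] Max_ge[OF this] ne obtain p
      where p: "(m, p) \<in> T" and max: "\<And>c. (m, c) \<in> T \<Longrightarrow> min_desc T c \<le> min_desc T p"
      by fastforce
    let ?S = "?C - {p}" and ?T = "contract m p T"
    have "m \<notin> W" using m by blast
    note ct = contract_tree[OF T this r p]
    note A = ct(2) m ct(4,5,3)
    \<comment> \<open>Maximality of \<open>p\<close> is strict because siblings have distinct least
      descendants.\<close>
    have "min_desc T c < min_desc T p" if "c \<in> ?S" for c
      using max[of c] that p inj_onD[OF min_desc_inj_on_siblings[OF T], of c p] le_neq_implies_less by blast
    then have "?S \<in> lower_children ?T p"
      using lower_children_iff[OF A] ct(1) by simp
    then have "(?T, p, ?S) \<in> ?P" using ct by simp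
    moreover have "T = ?f (?T, p, ?S)" using ct(1) by simp
    ultimately show "T \<in> ?f ` ?P" by blast
  qed
  ultimately have "sum g ?N = (\<Sum>(T, p, S) \<in> ?P. g (insert_above m p S T))"
    using sum.reindex[of ?f ?P g] by (simp add: case_prod_unfold o_def)
  moreover have "finite (lower_children T p)" if "is_rooted_tree W r T" for T p
    by (rule finite_subset[of _ "Pow {c. (p, c) \<in> T}"])
      (use lowS finite_children[OF finite_rooted_tree[OF that fin]] in auto)
  ultimately show ?thesis
    using fin finite_rooted_trees[OF fin] by (simp add: sum.Sigma[symmetric] finite_SigmaI)
qed

text \<open>The summands correspond to \<open>m\<close> as a leaf at the root, as a leaf at another
  vertex, and as an inner vertex, where \<open>sum_card_lower_children\<close> counts the choices of
  \<open>p\<close> and \<open>S\<close>. The weight \<open>f\<close> is arbitrary so that the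
  Laurent monomials can be substituted later.\<close>

lemma sum_rooted_trees_insert_max:
  fixes f :: "nat \<Rightarrow> nat \<Rightarrow> 'b::comm_semiring_1"
  assumes r: "r \<in> W" and min: "\<And>w. w \<in> W \<Longrightarrow> r \<le> w" and m: "\<forall>w \<in> W. w < m"
  defines "d \<equiv> \<lambda>T. num_children T r" and "k \<equiv> \<lambda>T. card (improper_edges T)"
  shows "(\<Sum>T | is_rooted_tree (insert m W) r T. f (d T) (k T)) =
    (\<Sum>T | is_rooted_tree W r T. f (d T + 1) (k T) + of_nat (card W - 1) * f (d T) (k T)
      + of_nat (card W - 1 + k T) * f (d T) (k T + 1))"
proof -
  have fin: "finite W" using m finite_nat_set_iff_bounded by blast
  let ?g = "\<lambda>T. f (d T) (k T)"
  have leaf: "(\<Sum>i \<in> W. ?g (insert (i, m) T)) = f (d T + 1) (k T) + of_nat (card W - 1) * ?g T"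
    if T: "is_rooted_tree W r T" for T
  proof -
    have "?g (insert (i, m) T) = f (d T + (if i = r then 1 else 0)) (k T)" if "i \<in> W" for i
      using num_children_insert_leaf[OF T m that finite_rooted_tree[OF T fin]]
        improper_edges_insert_leaf[OF T m that] by (simp add: d_def k_def)
    then have "(\<Sum>i \<in> W. ?g (insert (i, m) T)) = (\<Sum>i \<in> W. f (d T + (if i = r then 1 else 0)) (k T))"
      by simp
    also have "\<dots> = f (d T + 1) (k T) + (\<Sum>i \<in> W - {r}. f (d T + (if i = r then 1 else 0)) (k T))"
      using fin r by (simp add: sum.remove)
    also have "(\<Sum>i \<in> W - {r}. f (d T + (if i = r then 1 else 0)) (k T)) = (\<Sum>i \<in> W - {r}. f (d T) (k T))"
      by (rule sum.cong) auto
    finally show ?thesis using fin r by simp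
  qed
  have nonleaf: "(\<Sum>p \<in> W - {r}. \<Sum>S \<in> lower_children T p. ?g (insert_above m p S T))
      = of_nat (card W - 1 + k T) * f (d T) (k T + 1)" if T: "is_rooted_tree W r T" for T
  proof -
    have "?g (insert_above m p S T) = f (d T) (k T + 1)" if "p \<in> W - {r}" "S \<in> lower_children T p" for p S
      using that num_children_insert_above[OF T m _ _ _ finite_rooted_tree[OF T fin], of p S]
        card_improper_edges_insert_above[OF T m _ _ _ finite_rooted_tree[OF T fin], of p S]
      by (simp add: d_def k_def lower_children_def)
    then have "(\<Sum>p \<in> W - {r}. \<Sum>S \<in> lower_children T p. ?g (insert_above m p S T))
      = (\<Sum>p \<in> W - {r}. of_nat (card (lower_children T p)) * f (d T) (k T + 1))"
      by simp
    also have "\<dots> = of_nat (\<Sum>p \<in> W - {r}. card (lower_children T p)) * f (d T) (k T + 1)"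
      by (simp add: sum_distrib_right)
    finally show ?thesis
      using sum_card_lower_children[OF T fin min] by (simp add: k_def)
  qed
  let ?A = "{T. is_rooted_tree (insert m W) r T}" and ?L = "{T. {c. (m, c) \<in> T} = {}}"
  have "finite ?A" using finite_rooted_trees[of "insert m W"] fin by simp
  then have "sum ?g ?A = sum ?g (?A \<inter> ?L) + sum ?g (?A - ?L)"
    by (rule sum.Int_Diff)
  also have "sum ?g (?A \<inter> ?L) = (\<Sum>T | is_rooted_tree W r T. \<Sum>i \<in> W. ?g (insert (i, m) T))"
    using sum_leaf_trees[OF r m, of ?g] by (simp add: Int_def)
  also have "sum ?g (?A - ?L) = (\<Sum>T | is_rooted_tree W r T.
      \<Sum>p \<in> W - {r}. \<Sum>S \<in> lower_children T p. ?g (insert_above m p S T))"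
    using sum_nonleaf_trees[OF r m, of ?g] by (simp add: set_diff_eq)
  finally show ?thesis
    by (simp add: leaf nonleaf sum.distrib)
qed

section \<open>The grammar\<close>

lemma lpow_power: "lpow g e ^ k = lpow g (e * int k)"
  by (induction k) (simp_all add: lpow_0 lpow_add[symmetric] algebra_simps)

lemma lvar_power: "lvar g ^ k = lpow g (int k)"
  by (simp add: lvar_def lpow_power)

lemma is_derivation_sum:
  assumes "is_derivation D"
  shows "D (sum f S) = (\<Sum>s \<in> S. D (f s))"
proof -
  have add: "D (p + q) = D p + D q" for p q using assms by (simp add: is_derivation_def)
  from add[of 0 0] have "D 0 = 0" by simp
  then show ?thesis by (induction S rule: infinite_finite_induct) (simp_all add: add)
qed

text \<open>
  All five variables satisfy \<open>D p = p * a\<close> for some \<open>a\<close>, so \<open>D\<close> is computed on monomials through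
  logarithmic derivatives.
\<close>

lemma is_derivation_log_mult:
  assumes "is_derivation D" "D p = p * a" "D q = q * b"
  shows "D (p * q) = p * q * (a + b)"
  using assms by (simp add: is_derivation_def algebra_simps)

lemma is_derivation_log_power:
  assumes D: "is_derivation D" and p: "D p = p * a"
  shows "D (p ^ k) = p ^ k * (of_nat k * a)"
proof (induction k)
  case 0
  have "D (1 * 1) = D 1 * 1 + 1 * D 1" using D unfolding is_derivation_def by blast
  then show ?case by simp
next
  case (Suc k)
  then show ?case using is_derivation_log_mult[OF D p Suc] by (simp add: algebra_simps)
qed

text \<open>Logarithmic derivatives add up: \<open>A\<close> gives \<open>x v\<close>, the powers of
  \<open>X\<close> and \<open>Z\<close> give \<open>d v z + (n - d) v z = n v z\<close>, and those
  of \<open>V\<close> and \<open>U\<close> give \<open>(n + k) u v z\<close>. The common factor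
  \<open>v\<close> raises the exponent of \<open>V\<close>.\<close>

lemma grammar_derivation_monomial:
  assumes D: "is_derivation D" and G: "obeys_grammar D" and d: "d \<le> n"
  shows "D (lvar A * lvar V ^ n * lvar X ^ d * lvar Z ^ (n - d) * lvar U ^ k) =
    lvar A * lvar V ^ Suc n * lvar X ^ d * lvar Z ^ (n - d) * lvar U ^ k *
      (lvar X + of_nat n * lvar Z + of_nat (n + k) * (lvar U * lvar Z))"
proof -
  have "D (lvar A) = lvar A * (lvar X * lvar V)" "D (lvar X) = lvar X * (lvar V * lvar Z)"
    "D (lvar Z) = lvar Z * (lvar V * lvar Z)" "D (lvar V) = lvar V * (lvar U * lvar V * lvar Z)"
    "D (lvar U) = lvar U * (lvar U * lvar V * lvar Z)"
    using G by (simp_all add: obeys_grammar_def power2_eq_square mult_ac)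
  note L = this and P = is_derivation_log_power[OF D] and M = is_derivation_log_mult[OF D]
  have n: "(of_nat n :: 'a laurent) = of_nat d + of_nat (n - d)"
    using d by (simp flip: of_nat_add)
  show ?thesis
    unfolding M[OF M[OF M[OF M[OF L(1) P[OF L(4)]] P[OF L(2)]] P[OF L(3)]] P[OF L(5)]]
    by (simp add: n algebra_simps)
qed

section \<open>Bounds on the root degree and the number of improper edges\<close>

lemma num_children_root_le:
  assumes "is_rooted_tree W r T" "finite W"
  shows "num_children T r \<le> card W - 1"
proof -
  have "{j. (r, j) \<in> T} \<subseteq> W - {r}" using rooted_treeD(2,3)[OF assms(1)] by blast
  from card_mono[OF _ this] show ?thesis
    using assms rooted_treeD(4)[OF assms(1)] by (simp add: num_children_def)
qed

lemma ex_root_child: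
  assumes T: "is_rooted_tree W r T" and w: "w \<in> W" "w \<noteq> r"
  obtains j where "(r, j) \<in> T"
  using rooted_treeD(5)[OF T w(1)] w(2) by (metis converse_rtranclE)

lemma num_children_root_pos:
  assumes "is_rooted_tree W r T" "finite W" "w \<in> W" "w \<noteq> r"
  shows "num_children T r > 0"
  using ex_root_child[OF assms(1,3,4)] finite_children[OF finite_rooted_tree[OF assms(1,2)], of r]
  by (metis card_gt_0_iff empty_iff mem_Collect_eq num_children_def)

text \<open>Two vertices are never the child in an improper edge: the root, which has no parent, and
  a child of the root, since no label is below \<open>r\<close>.\<close>

lemma card_improper_edges_le:
  assumes T: "is_rooted_tree W r T" and fin: "finite W" and min: "\<forall>w \<in> W. r \<le> w"
    and w: "w \<in> W" "w \<noteq> r"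
  shows "card (improper_edges T) \<le> card W - 2"
proof -
  obtain j where j: "(r, j) \<in> T" using ex_root_child[OF T w] .
  have jW: "j \<in> W" "j \<noteq> r" using rooted_treeD(2,3)[OF T j] by auto
  have "min_desc T j \<in> W" using rooted_tree_descendants_subset[OF T jW(1)] min_desc_in by blast
  then have "r \<le> min_desc T j" using min by blast
  then have "j \<notin> Range (improper_edges T)"
    using rooted_tree_parent_unique[OF T j] by (fastforce simp: improper_edges_iff)
  then have "Range (improper_edges T) \<subseteq> W - {r, j}"
    using rooted_treeD(2,3)[OF T] by (fastforce simp: improper_edges_iff)
  from card_mono[OF _ this] show ?thesis
    using fin jW rooted_treeD(4)[OF T] by (simp add: card_Range_improper_edges[OF T] numeral_2_eq_2)
qed

lemma grammar_derivation_iterate: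
  fixes D :: "'c::comm_ring_1 laurent \<Rightarrow> 'c laurent"
  assumes D: "is_derivation D" and G: "obeys_grammar D"
  shows "(D ^^ n) (lvar A) = (\<Sum>T | is_rooted_tree {1..n + 1} 1 T.
    lvar A * lvar V ^ n * lvar X ^ num_children T 1 * lvar Z ^ (n - num_children T 1) *
      lvar U ^ card (improper_edges T))"
proof (induction n)
  case 0
  have "{T. is_rooted_tree {1..0 + 1} 1 T} = {{} :: (nat \<times> nat) set}"
    by (auto simp: is_rooted_tree_def)
  then show ?case by (simp add: num_children_def improper_edges_def)
next
  case (Suc n)
  define f :: "nat \<Rightarrow> nat \<Rightarrow> 'c laurent" where
    "f = (\<lambda>d k. lvar A * lvar V ^ Suc n * lvar X ^ d * lvar Z ^ (Suc n - d) * lvar U ^ k)"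
  \<comment> \<open>The factors \<open>x\<close>, \<open>z\<close> and \<open>u z\<close> of the
    derivative match the three summands of the tree recurrence; \<open>d <= n\<close> keeps the
    exponent of \<open>Z\<close> exact.\<close>
  have step: "D (lvar A * lvar V ^ n * lvar X ^ d * lvar Z ^ (n - d) * lvar U ^ k) =
      f (d + 1) k + of_nat n * f d k + of_nat (n + k) * f d (k + 1)" if "d \<le> n" for d k
    using that unfolding grammar_derivation_monomial[OF D G that]
    by (simp add: f_def Suc_diff_le algebra_simps)
  have le: "num_children T 1 \<le> n" if "is_rooted_tree {1..n + 1} 1 T" for T
    using num_children_root_le[OF that] by simp
  have "(D ^^ Suc n) (lvar A) = (\<Sum>T | is_rooted_tree {1..n + 1} 1 T.
      D (lvar A * lvar V ^ n * lvar X ^ num_children T 1 * lvar Z ^ (n - num_children T 1) *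
        lvar U ^ card (improper_edges T)))"
    by (simp add: Suc.IH is_derivation_sum[OF D])
  also have "\<dots> = (\<Sum>T | is_rooted_tree (insert (n + 2) {1..n + 1}) 1 T.
      f (num_children T 1) (card (improper_edges T)))"
    using le by (subst sum_rooted_trees_insert_max) (auto simp: step intro!: sum.cong)
  also have "insert (n + 2) {1..n + 1} = {1..Suc n + 1}" by auto
  finally show ?case by (simp only: f_def)
qed

section \<open>The two closed forms\<close>

lemma poly_map_poly_of_int_sum_monom:
  fixes y :: "'a::comm_ring_1"
  shows "poly (map_poly of_int (\<Sum>s \<in> S. monom 1 (e s))) y = (\<Sum>s \<in> S. y ^ e s)"
proof -
  have "map_poly of_int (\<Sum>s \<in> S. monom 1 (e s)) = (\<Sum>s \<in> S. monom (1 :: 'a) (e s))"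
    by (rule poly_eqI) (auto simp: coeff_map_poly coeff_sum intro!: sum.cong)
  then show ?thesis by (simp add: poly_sum poly_monom)
qed

theorem theorem3p3:
  fixes D :: "'c::comm_ring_1 laurent \<Rightarrow> 'c laurent" and n :: nat
  assumes "is_derivation D" and "obeys_grammar D" and "n \<ge> 1"
  shows "((D ^^ n) (lvar A) =
           lvar A * lvar V ^ n *
           (\<Sum>k = 0..n - 1. \<Sum>T \<in> trees (n + 1) k.
              lvar X ^ num_children T 1 * lpow Z (int n - int (num_children T 1)) * lvar U ^ k))
       \<and> ((D ^^ n) (lvar A) =
           lvar A * lvar X * lvar V ^ n * lvar Z ^ (n - 1) *
           (\<Sum>k = 0..n - 1. poly (map_poly of_int (ramanujan_poly n k)) (lvar X * lpow Z (-1)) * lvar U ^ k))"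
proof -
  let ?d = "\<lambda>T. num_children T 1" and ?W = "{1..n + 1}"
  let ?w = "\<lambda>T. lvar X ^ ?d T * lpow Z (int n - int (?d T)) * lvar U ^ card (improper_edges T) :: 'c laurent"
  \<comment> \<open>As \<open>n >= 1\<close>, the vertex 2 is a non-root vertex; it yields the
    positive root degree and the bound \<open>n - 1\<close>, by which \<open>k\<close> from 0 to
    \<open>n - 1\<close> covers all trees.\<close>
  have d: "?d T \<le> n" "?d T > 0" "card (improper_edges T) \<le> n - 1" if "is_rooted_tree ?W 1 T" for T
    using num_children_root_le[OF that] num_children_root_pos[OF that, of 2]
      card_improper_edges_le[OF that, of 2] assms(3) by auto
  have "(D ^^ n) (lvar A) = (\<Sum>T | is_rooted_tree ?W 1 T. lvar A * lvar V ^ n * ?w T)"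
    unfolding grammar_derivation_iterate[OF assms(1,2)]
    using d(1) by (intro sum.cong) (auto simp: lvar_power of_nat_diff mult_ac)
  also have "\<dots> = lvar A * lvar V ^ n * (\<Sum>T | is_rooted_tree ?W 1 T. ?w T)"
    by (simp add: sum_distrib_left)
  also have "(\<Sum>T | is_rooted_tree ?W 1 T. ?w T) =
      (\<Sum>k \<in> {0..n - 1}. \<Sum>T | T \<in> {T. is_rooted_tree ?W 1 T} \<and> card (improper_edges T) = k. ?w T)"
    using d(3) finite_rooted_trees[of ?W] by (intro sum.group[symmetric]) auto
  also have "\<dots> = (\<Sum>k = 0..n - 1. \<Sum>T \<in> trees (n + 1) k.
      lvar X ^ ?d T * lpow Z (int n - int (?d T)) * lvar U ^ k)"
    by (intro sum.cong) (auto simp: trees_def)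
  finally have first: "(D ^^ n) (lvar A) = lvar A * lvar V ^ n * (\<Sum>k = 0..n - 1. \<Sum>T \<in> trees (n + 1) k.
      lvar X ^ ?d T * lpow Z (int n - int (?d T)) * lvar U ^ k)" .
  \<comment> \<open>One factor \<open>x\<close> and \<open>n - 1\<close> factors \<open>z\<close>
    are split off; the rest is a power of \<open>x / z\<close>. A positive root degree makes the
    exponent \<open>?d T - 1\<close> exact.\<close>
  have weight: "(lvar X :: 'c laurent) ^ ?d T * lpow Z (int n - int (?d T)) =
      lvar X * lvar Z ^ (n - 1) * (lvar X * lpow Z (-1)) ^ (?d T - 1)"
    if "T \<in> trees (n + 1) k" for T k
  proof -
    have "?d T > 0" using d that by (simp add: trees_def)
    then obtain e where e: "?d T = Suc e" using gr0_implies_Suc by blast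
    have "(lpow Z (int n - int (Suc e)) :: 'c laurent) = lvar Z ^ (n - 1) * lpow Z (-1) ^ e"
    proof -
      have "int n - int (Suc e) = int (n - 1) + (-1) * int e" using assms(3) by simp
      then show ?thesis by (simp only: lvar_power lpow_power lpow_add)
    qed
    then show ?thesis
      unfolding e power_mult_distrib by (simp only: power_Suc diff_Suc_1 mult_ac)
  qed
  have eq: "(\<Sum>k = 0..n - 1. \<Sum>T \<in> trees (n + 1) k.
        (lvar X :: 'c laurent) ^ ?d T * lpow Z (int n - int (?d T)) * lvar U ^ k) =
      lvar X * lvar Z ^ (n - 1) *
      (\<Sum>k = 0..n - 1. poly (map_poly of_int (ramanujan_poly n k)) (lvar X * lpow Z (-1)) * lvar U ^ k)"
    unfolding ramanujan_poly_def poly_map_poly_of_int_sum_monom sum_distrib_left sum_distrib_right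
    by (intro sum.cong refl) (simp only: weight mult.assoc)
  have assoc: "a * v * (x * z * s) = a * x * v * z * s" for a v x z s :: "'c laurent"
    by (simp only: mult_ac)
  show ?thesis
    using first first[unfolded eq assoc] by (rule conjI)
qed

end
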